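(* Let $\mathcal{S}=\langle\mathcal{L},\vdash\rangle$ be a monotonic and transitive logic, where $\mathcal{L}$ is the formula algebra over a nonempty set of variables $V$ in a finite signature containing a binary conjunction operator $\land$, and suppose that for all $\alpha,\beta\in\mathcal{L}$, $\{\alpha\land\beta\}\vdash\alpha$ and $\{\alpha\land\beta\}\vdash\beta$. If $\mathcal{S}$ is finitely trivializable, then spECQ, pfECQ, and gECQ hold in $\mathcal{S}$.
   Context: A logic is a pair $\langle\mathcal{L},\vdash\rangle$ with $\vdash\,\subseteq\mathcal{P}(\mathcal{L})\times\mathcal{L}$; $C_\vdash(\Gamma)=\{\alpha:\Gamma\vdash\alpha\}$. Monotonic: $\Gamma\subseteq\Sigma$ implies $C_\vdash(\Gamma)\subseteq C_\vdash(\Sigma)$. Transitive: $\Sigma\subseteq C_\vdash(\Gamma)$ implies $C_\vdash(\Sigma)\subseteq C_\vdash(\Gamma)$. Finitely trivializable: there is a finite $\Gamma\subseteq\mathcal{L}$ with $C_\vdash(\Gamma)=\mathcal{L}$. spECQ: for every $\Gamma\subsetneq\mathcal{L}$ there is $\alpha\in\mathcal{L}$ with $\Gamma\cup\{\alpha\}\subsetneq\mathcal{L}$ and $C_\vdash(\Gamma\cup\{\alpha\})=\mathcal{L}$. pfECQ: for every $\Gamma\subsetneq\mathcal{L}$ there is $\Delta\subsetneq\mathcal{L}$ with $\Gamma\subseteq\Delta$ and $C_\vdash(\Delta)=\mathcal{L}$. gECQ: for each $\alpha\in\mathcal{L}$ there is $\beta\in\mathcal{L}$ with $C_\vdash(\{\alpha,\beta\})=\mathcal{L}$.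 *)

theory Defs imports Main begin

datatype ('f, 'v) fm = Var 'v | Op 'f "('f, 'v) fm list"

text \<open>
  Carrier of the formula algebra over the variables \<open>V\<close> in the signature with operator
  symbols \<open>F\<close>, where \<open>ar f\<close> is the arity of \<open>f\<close>. Its operations are the term
  constructors; in particular a binary operator \<open>f\<close> sends \<open>\<alpha>, \<beta>\<close> to \<open>Op f [\<alpha>, \<beta>]\<close>.
\<close>

inductive_set formulas :: "'f set \<Rightarrow> ('f \<Rightarrow> nat) \<Rightarrow> 'v set \<Rightarrow> ('f, 'v) fm set"
  for F :: "'f set" and ar :: "'f \<Rightarrow> nat" and V :: "'v set" where
  Var: "v \<in> V \<Longrightarrow> Var v \<in> formulas F ar V"
| Op: "f \<in> F \<Longrightarrow> length ts = ar f \<Longrightarrow> \<forall>t \<in> set ts. t \<in> formulas F ar V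
    \<Longrightarrow> Op f ts \<in> formulas F ar V"

definition is_logic :: "'a set \<Rightarrow> ('a set \<times> 'a) set \<Rightarrow> bool" where
  "is_logic L R \<longleftrightarrow> R \<subseteq> Pow L \<times> L"

definition Cn :: "('a set \<times> 'a) set \<Rightarrow> 'a set \<Rightarrow> 'a set" where
  "Cn R \<Gamma> = {\<alpha>. (\<Gamma>, \<alpha>) \<in> R}"

definition monotonic :: "'a set \<Rightarrow> ('a set \<times> 'a) set \<Rightarrow> bool" where
  "monotonic L R \<longleftrightarrow>
    (\<forall>\<Gamma> \<Sigma>. \<Gamma> \<subseteq> L \<longrightarrow> \<Sigma> \<subseteq> L \<longrightarrow> \<Gamma> \<subseteq> \<Sigma> \<longrightarrow> Cn R \<Gamma> \<subseteq> Cn R \<Sigma>)"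

definition transitive :: "'a set \<Rightarrow> ('a set \<times> 'a) set \<Rightarrow> bool" where
  "transitive L R \<longleftrightarrow>
    (\<forall>\<Gamma> \<Sigma>. \<Gamma> \<subseteq> L \<longrightarrow> \<Sigma> \<subseteq> L \<longrightarrow> \<Sigma> \<subseteq> Cn R \<Gamma> \<longrightarrow> Cn R \<Sigma> \<subseteq> Cn R \<Gamma>)"

definition finitely_trivializable :: "'a set \<Rightarrow> ('a set \<times> 'a) set \<Rightarrow> bool" where
  "finitely_trivializable L R \<longleftrightarrow> (\<exists>\<Gamma>. finite \<Gamma> \<and> \<Gamma> \<subseteq> L \<and> Cn R \<Gamma> = L)"

definition spECQ :: "'a set \<Rightarrow> ('a set \<times> 'a) set \<Rightarrow> bool" where
  "spECQ L R \<longleftrightarrow>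
    (\<forall>\<Gamma>. \<Gamma> \<subset> L \<longrightarrow> (\<exists>\<alpha> \<in> L. \<Gamma> \<union> {\<alpha>} \<subset> L \<and> Cn R (\<Gamma> \<union> {\<alpha>}) = L))"

definition pfECQ :: "'a set \<Rightarrow> ('a set \<times> 'a) set \<Rightarrow> bool" where
  "pfECQ L R \<longleftrightarrow> (\<forall>\<Gamma>. \<Gamma> \<subset> L \<longrightarrow> (\<exists>\<Delta>. \<Delta> \<subset> L \<and> \<Gamma> \<subseteq> \<Delta> \<and> Cn R \<Delta> = L))"

definition gECQ :: "'a set \<Rightarrow> ('a set \<times> 'a) set \<Rightarrow> bool" where
  "gECQ L R \<longleftrightarrow> (\<forall>\<alpha> \<in> L. \<exists>\<beta> \<in> L. Cn R {\<alpha>, \<beta>} = L)"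

end

theory Submission imports Defs begin

text \<open>
  Iterated conjunction turns a finite trivializing set into a single trivializing formula \<open>\<delta>\<close>,
  and then \<open>\<delta> \<and> \<delta>\<close> is a second one. A proper subset of the language either contains a
  trivializing formula already, or omits both of these, so that adding \<open>\<delta>\<close> leaves it proper.
\<close>

lemma Cn_subset: "is_logic L R \<Longrightarrow> Cn R \<Gamma> \<subseteq> L"
  by (auto simp: is_logic_def Cn_def)

lemma Cn_mono: "monotonic L R \<Longrightarrow> \<Gamma> \<subseteq> \<Sigma> \<Longrightarrow> \<Sigma> \<subseteq> L \<Longrightarrow> Cn R \<Gamma> \<subseteq> Cn R \<Sigma>"
  by (simp add: monotonic_def subset_trans[of \<Gamma> \<Sigma> L])

lemma Cn_trans:
  "transitive L R \<Longrightarrow> \<Gamma> \<subseteq> L \<Longrightarrow> \<Sigma> \<subseteq> L \<Longrightarrow> \<Sigma> \<subseteq> Cn R \<Gamma> \<Longrightarrow> Cn R \<Sigma> \<subseteq> Cn R \<Gamma>"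
  unfolding transitive_def by blast

lemma trivial_superset:
  assumes "is_logic L R" "monotonic L R" "Cn R \<Gamma> = L" "\<Gamma> \<subseteq> \<Sigma>" "\<Sigma> \<subseteq> L"
  shows "Cn R \<Sigma> = L"
  using Cn_subset[OF assms(1), of \<Sigma>] Cn_mono[OF assms(2,4,5)] assms(3) by simp

text \<open>Induction on \<open>\<Gamma>\<close>: if \<open>\<delta>\<close> entails
  \<open>\<Gamma>\<close>, then \<open>c \<alpha> \<delta>\<close> entails \<open>\<alpha>\<close>
  directly and, since it entails \<open>\<delta>\<close>, also \<open>\<Gamma>\<close> by
  transitivity. Reflexivity is not assumed, so \<open>\<alpha>\<close> cannot serve as its own
  premise. The induction therefore starts at the empty set, with an arbitrary formula of
  \<open>L\<close>.\<close>

lemma ex_formula_entailing_finite: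
  assumes "transitive L R" "L \<noteq> {}"
    and c: "\<And>\<alpha> \<beta>. \<alpha> \<in> L \<Longrightarrow> \<beta> \<in> L \<Longrightarrow> c \<alpha> \<beta> \<in> L \<and> \<alpha> \<in> Cn R {c \<alpha> \<beta>} \<and> \<beta> \<in> Cn R {c \<alpha> \<beta>}"
    and "finite \<Gamma>" "\<Gamma> \<subseteq> L"
  shows "\<exists>\<delta>\<in>L. \<Gamma> \<subseteq> Cn R {\<delta>}"
  using assms(4,5)
proof (induction \<Gamma> rule: finite_induct)
  case empty
  then show ?case using \<open>L \<noteq> {}\<close> by auto
next
  case (insert \<alpha> \<Gamma>)
  then obtain \<delta> where \<delta>: "\<delta> \<in> L" "\<Gamma> \<subseteq> Cn R {\<delta>}" by auto
  have \<alpha>: "\<alpha> \<in> L" using insert.prems by simp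
  have "Cn R {\<delta>} \<subseteq> Cn R {c \<alpha> \<delta>}"
    using c[OF \<alpha> \<delta>(1)] \<delta>(1) by (intro Cn_trans[OF assms(1)]) auto
  then show ?case using c[OF \<alpha> \<delta>(1)] \<delta>(2) by blast
qed

text \<open>One trivializing formula \<open>\<delta>\<close> would not suffice here: adding it to
  \<open>L - {\<delta>}\<close> gives all of \<open>L\<close>. A second one serves as the formula
  left out.\<close>

lemma spECQ_if_two_trivializing_formulas:
  assumes "is_logic L R" "monotonic L R"
    and "\<delta> \<in> L" "Cn R {\<delta>} = L" "\<epsilon> \<in> L" "Cn R {\<epsilon>} = L" "\<delta> \<noteq> \<epsilon>"
  shows "spECQ L R"
  unfolding spECQ_def
proof (intro allI impI)
  fix \<Gamma> assume \<Gamma>: "\<Gamma> \<subset> L"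
  obtain \<alpha> where \<alpha>: "\<alpha> \<in> L" "Cn R {\<alpha>} = L" "\<Gamma> \<union> {\<alpha>} \<subset> L"
  \<comment> \<open>If \<open>\<epsilon> \<in> \<Gamma>\<close>, adding \<open>\<epsilon>\<close>
    changes nothing and \<open>\<Gamma>\<close> stays proper. Otherwise \<open>\<delta>\<close> is
    added, and \<open>\<epsilon> \<noteq> \<delta>\<close> remains outside.\<close>
  proof (cases "\<epsilon> \<in> \<Gamma>")
    case True
    then have "\<Gamma> \<union> {\<epsilon>} \<subset> L" using \<Gamma> by (simp add: insert_absorb)
    then show ?thesis using that assms by blast
  next
    case False
    then have "\<Gamma> \<union> {\<delta>} \<subset> L" using \<Gamma> assms by blast
    then show ?thesis using that assms by blast
  qed
  have "Cn R (\<Gamma> \<union> {\<alpha>}) = L"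
    using \<alpha>(3)
    by (intro trivial_superset[OF assms(1,2) \<alpha>(2)]) auto
  then show "\<exists>\<alpha>\<in>L. \<Gamma> \<union> {\<alpha>} \<subset> L \<and> Cn R (\<Gamma> \<union> {\<alpha>}) = L" using \<alpha> by blast
qed

text \<open>The extension \<open>\<Gamma> \<union> {\<alpha>}\<close> serves as
  \<open>\<Delta>\<close>.\<close>

lemma spECQ_imp_pfECQ: "spECQ L R \<Longrightarrow> pfECQ L R"
  unfolding spECQ_def pfECQ_def by (metis Un_upper1)

text \<open>The same \<open>\<beta> = \<delta>\<close> works for every \<open>\<alpha>\<close>, by
  monotonicity.\<close>

lemma gECQ_if_trivializing_formula:
  assumes "is_logic L R" "monotonic L R" "\<delta> \<in> L" "Cn R {\<delta>} = L"
  shows "gECQ L R"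
  unfolding gECQ_def
proof
  fix \<alpha> assume "\<alpha> \<in> L"
  then have "Cn R {\<alpha>, \<delta>} = L"
    using assms(3) by (intro trivial_superset[OF assms(1,2,4)]) auto
  then show "\<exists>\<beta>\<in>L. Cn R {\<alpha>, \<beta>} = L" using assms(3) by blast
qed

theorem theorem3p31:
  fixes F :: "'f set" and ar :: "'f \<Rightarrow> nat" and V :: "'v set"
    and conj :: 'f
    and L :: "('f, 'v) fm set" and R :: "(('f, 'v) fm set \<times> ('f, 'v) fm) set"
  assumes "finite F" and "conj \<in> F" and "ar conj = 2" and "V \<noteq> {}"
    and "L = formulas F ar V"
    and "is_logic L R" and "monotonic L R" and "transitive L R"
    and "\<And>\<alpha> \<beta>. \<alpha> \<in> L \<Longrightarrow> \<beta> \<in> L \<Longrightarrow>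
      ({Op conj [\<alpha>, \<beta>]}, \<alpha>) \<in> R \<and> ({Op conj [\<alpha>, \<beta>]}, \<beta>) \<in> R"
    and "finitely_trivializable L R"
  shows "spECQ L R \<and> pfECQ L R \<and> gECQ L R"
proof -
  have nonempty: "L \<noteq> {}" unfolding assms(5) using assms(4) by (auto intro: formulas.Var)
  have c: "Op conj [\<alpha>, \<beta>] \<in> L \<and> \<alpha> \<in> Cn R {Op conj [\<alpha>, \<beta>]} \<and> \<beta> \<in> Cn R {Op conj [\<alpha>, \<beta>]}"
    if "\<alpha> \<in> L" "\<beta> \<in> L" for \<alpha> \<beta>
  proof -
    have "Op conj [\<alpha>, \<beta>] \<in> L"
      unfolding assms(5) by (rule formulas.Op) (use assms(2,3) that[unfolded assms(5)] in simp_all)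
    then show ?thesis using assms(9)[OF that] by (simp add: Cn_def)
  qed
  obtain \<Gamma> where \<Gamma>: "finite \<Gamma>" "\<Gamma> \<subseteq> L" "Cn R \<Gamma> = L"
    using assms(10) unfolding finitely_trivializable_def by blast
  obtain \<delta> where \<delta>: "\<delta> \<in> L" "\<Gamma> \<subseteq> Cn R {\<delta>}"
    using ex_formula_entailing_finite[where c = "\<lambda>\<alpha> \<beta>. Op conj [\<alpha>, \<beta>]",
        OF assms(8) nonempty c \<Gamma>(1,2)] by blast
  \<comment> \<open>Transitivity passes from \<open>\<Gamma> \<subseteq> Cn R {\<delta>}\<close> to
    \<open>Cn R \<Gamma> \<subseteq> Cn R {\<delta>}\<close>, and \<open>Cn R \<Gamma>\<close> is
    already \<open>L\<close>.\<close>
  have "L \<subseteq> Cn R {\<delta>}"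
    using Cn_trans[OF assms(8) _ \<Gamma>(2) \<delta>(2)] \<delta>(1) \<Gamma>(3) by simp
  then have triv: "Cn R {\<delta>} = L" using Cn_subset[OF assms(6)] by blast
  \<comment> \<open>Conjoining \<open>\<delta>\<close> with itself gives a formula that entails
    \<open>\<delta>\<close>, hence by transitivity everything.\<close>
  let ?\<epsilon> = "Op conj [\<delta>, \<delta>]"
  have "Cn R {\<delta>} \<subseteq> Cn R {?\<epsilon>}"
    using c[OF \<delta>(1) \<delta>(1)] \<delta>(1) by (intro Cn_trans[OF assms(8)]) auto
  then have "Cn R {?\<epsilon>} = L" using triv Cn_subset[OF assms(6)] by blast
  \<comment> \<open>Formulas are free terms, so \<open>\<delta>\<close> is a proper subterm of
    \<open>?\<epsilon>\<close> and has strictly smaller size.\<close>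
  moreover have "\<delta> \<noteq> ?\<epsilon>"
  proof
    assume "\<delta> = ?\<epsilon>"
    then have "size \<delta> = size ?\<epsilon>" by (rule arg_cong)
    then show False by simp
  qed
  ultimately have "spECQ L R"
    using spECQ_if_two_trivializing_formulas[OF assms(6,7) \<delta>(1) triv] c[OF \<delta>(1) \<delta>(1)] by blast
  then show ?thesis
    using spECQ_imp_pfECQ gECQ_if_trivializing_formula[OF assms(6,7) \<delta>(1) triv] by blast
qed

end
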